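(* Let $\sigma>0$, $\alpha\in[0,1]$ and $\kappa\in\mathbb{R}$ be fixed, and let $Z_1,Z_2,\dots$ be i.i.d. standard normal random variables. Put $S_0=0$, $S_n=\sigma\sum_{i=1}^n Z_i-\kappa\sigma n^{\alpha}$ for $n\ge 1$ (with $n^0=1$), and $L_N=\max_{0\le j\le N}S_j$. Then, as $N\to\infty$: (i) if $\kappa>0$ and $\alpha\in(\tfrac12,1]$, then $\mathbf{E}[L_N]$ is bounded in $N$; (ii) if $\kappa>0$ and $\alpha\in[0,\tfrac12]$, then $\mathbf{E}[L_N]$ grows on the order of $\sqrt N$; (iii) if $\kappa<0$ and $\alpha\in(\tfrac12,1]$, then $\mathbf{E}[L_N]$ grows on the order of $N^{\alpha}$; (iv) if $\kappa<0$ and $\alpha\in[0,\tfrac12]$, then $\mathbf{E}[L_N]$ grows on the order of $\sqrt N$.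
   Context: Setting: the demand in period $n$ is $D_n=\mu_n+\sigma Z_n$, the cumulative supply is $x_1+\cdots+x_n=\mu_1+\cdots+\mu_n+\kappa\sigma n^\alpha$, $S_n=\sum_{i\le n}(D_i-x_i)$ is the net cumulative demand, and $L_N$ is the cumulative lost sales up to period $N$. "Grows on the order of $f(N)$" means that there are constants $0<c_1\le c_2<\infty$ (depending on $\sigma,\alpha,\kappa$ but not on $N$) such that $c_1 f(N)\le \mathbf{E}[L_N]\le c_2 f(N)$ for all sufficiently large $N$. *)

theory Defs
  imports "HOL-Probability.Probability"
begin

definition grows_on_order_of :: "(nat \<Rightarrow> real) \<Rightarrow> (nat \<Rightarrow> real) \<Rightarrow> bool" where
  "grows_on_order_of f g \<longleftrightarrow>
     (\<exists>c1 c2. 0 < c1 \<and> c1 \<le> c2 \<and> (\<forall>\<^sub>F N in sequentially. c1 * g N \<le> f N \<and> f N \<le> c2 * g N))"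

(* Net cumulative demand. Only Z 1, Z 2, ... are used. For n \<ge> 1 the term real n powr \<alpha> is
   the usual power, in particular it equals 1 when \<alpha> = 0. *)
definition net_demand ::
    "real \<Rightarrow> real \<Rightarrow> real \<Rightarrow> (nat \<Rightarrow> 'a \<Rightarrow> real) \<Rightarrow> nat \<Rightarrow> 'a \<Rightarrow> real" where
  "net_demand \<sigma> \<alpha> \<kappa> Z n \<omega> =
     (if n = 0 then 0 else \<sigma> * (\<Sum>i=1..n. Z i \<omega>) - \<kappa> * \<sigma> * real n powr \<alpha>)"

definition lost_sales ::
    "real \<Rightarrow> real \<Rightarrow> real \<Rightarrow> (nat \<Rightarrow> 'a \<Rightarrow> real) \<Rightarrow> nat \<Rightarrow> 'a \<Rightarrow> real" where
  "lost_sales \<sigma> \<alpha> \<kappa> Z N \<omega> = Max ((\<lambda>j. net_demand \<sigma> \<alpha> \<kappa> Z j \<omega>) ` {0..N})"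

end

theory Submission
  imports Defs
begin

text \<open>
  Write \<open>W n = Z 1 + \<dots> + Z n\<close>, so that \<open>S n = \<sigma> * (W n - \<kappa> * n powr \<alpha>)\<close>. Everything rests on
  two facts about \<open>W\<close>: \<open>W n / sqrt n\<close> is standard normal, and the running maximum of \<open>W\<close> up to
  time \<open>N\<close> has expectation at most \<open>5/2 * sqrt N\<close>.

  The second fact (\<open>expectation_run_max_walk_le\<close>) is a weak form of Doob's \<open>L\<^sup>2\<close> inequality, and it
  has a proof without stopping times. With \<open>M n\<close> the running maximum, the pathwise inequality
  \<open>(M N)\<^sup>2 \<le> 4 * (W N)\<^sup>2 - 4 * (\<Sum>k<N. M k * (W (k + 1) - W k))\<close> holds (\<open>run_max_square_le\<close>), and the
  sum on the right has expectation zero because \<open>M k\<close> depends only on \<open>Z 1, \<dots>, Z k\<close>. Hence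
  \<open>E (M N)\<^sup>2 \<le> 4 * N\<close>.

  Upper bounds: the drift contributes at most \<open>max 0 (- \<kappa>) * N powr \<alpha>\<close> to \<open>L N / \<sigma>\<close>, and the rest is
  at most the running maximum of \<open>W\<close>. The larger of \<open>sqrt N\<close> and \<open>N powr \<alpha>\<close> therefore dominates.
  Lower bounds: \<open>L N\<close> is at least both \<open>S N\<close> and \<open>0\<close>. The mean \<open>- \<kappa> * \<sigma> * N powr \<alpha>\<close> of \<open>S N\<close>
  settles \<open>\<kappa> < 0\<close>, \<open>\<alpha> > 1/2\<close>. If \<open>\<alpha> \<le> 1/2\<close> then the drift is at most of order \<open>sqrt N\<close>, so
  with \<open>Y\<close> standard normal the positive part of \<open>S N\<close> has expectation at least
  \<open>\<sigma> * sqrt N * E (max 0 (Y - \<bar>\<kappa>\<bar>))\<close>, a positive multiple of \<open>sqrt N\<close>.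

  If \<open>\<kappa> > 0\<close> and \<open>\<alpha> > 1/2\<close>, the drift beats the fluctuations by a positive power of \<open>j\<close> at every
  time \<open>j\<close>; bounding the maximum by the sum of the positive parts of all \<open>S j\<close> loses nothing that
  matters, since a moment bound of high enough order makes this sum converge.
\<close>

section \<open>Running maxima and a pathwise inequality\<close>

definition run_max :: "(nat \<Rightarrow> real) \<Rightarrow> nat \<Rightarrow> real" where
  "run_max w n = Max (w ` {0..n})"

lemma run_max_0: "run_max w 0 = w 0"
  by (simp add: run_max_def)

lemma run_max_Suc: "run_max w (Suc n) = max (run_max w n) (w (Suc n))"
  by (simp add: run_max_def atLeast0_atMost_Suc max.commute)

lemma run_max_ge: "j \<le> n \<Longrightarrow> w j \<le> run_max w n"
  by (simp add: run_max_def)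

lemma run_max_le_iff: "run_max w n \<le> c \<longleftrightarrow> (\<forall>j\<le>n. w j \<le> c)"
  by (auto simp: run_max_def)

text \<open>
  Summation by parts: the running maximum \<open>m\<close> only increases at times when it equals \<open>w\<close>, and
  there \<open>m'\<^sup>2 - m\<^sup>2 \<le> 2 * (m' - m) * m'\<close>.
\<close>

lemma run_max_square_le_aux:
  assumes "w 0 = 0"
  shows "(run_max w n)\<^sup>2 \<le> 2 * run_max w n * w n - 2 * (\<Sum>k<n. run_max w k * (w (Suc k) - w k))"
proof (induction n)
  case 0
  then show ?case using assms by (simp add: run_max_0)
next
  case (Suc n)
  let ?m = "run_max w n" and ?m' = "run_max w (Suc n)"
  have "?m'\<^sup>2 - ?m\<^sup>2 \<le> 2 * (?m' - ?m) * w (Suc n)"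
  proof (cases "w (Suc n) \<le> ?m")
    case True
    then show ?thesis by (simp add: run_max_Suc max_def)
  next
    case False
    then have "?m' = w (Suc n)" by (simp add: run_max_Suc)
    moreover have "0 \<le> (w (Suc n) - ?m)\<^sup>2" by simp
    ultimately show ?thesis by (simp add: power2_eq_square algebra_simps)
  qed
  with Suc show ?case by (simp add: algebra_simps)
qed

lemma run_max_square_le:
  assumes "w 0 = 0"
  shows "(run_max w n)\<^sup>2 \<le> 4 * (w n)\<^sup>2 - 4 * (\<Sum>k<n. run_max w k * (w (Suc k) - w k))"
proof -
  have "0 \<le> (run_max w n - 2 * w n)\<^sup>2" by simp
  then have "4 * run_max w n * w n \<le> (run_max w n)\<^sup>2 + 4 * (w n)\<^sup>2"
    by (simp add: power2_eq_square algebra_simps)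
  with run_max_square_le_aux[of w n, OF assms] show ?thesis by linarith
qed

lemma integrable_run_max:
  assumes "\<And>j. integrable M (\<lambda>\<omega>. X j \<omega>)"
  shows "integrable M (\<lambda>\<omega>. run_max (\<lambda>j. X j \<omega>) n)"
  by (induction n) (auto simp: run_max_0 run_max_Suc assms)

section \<open>Excesses of the standard normal distribution\<close>

definition normal_excess :: "real \<Rightarrow> real" where
  "normal_excess c = (\<integral>x. std_normal_density x * max 0 (x - c) \<partial>lborel)"

lemma integrable_normal_excess: "integrable lborel (\<lambda>x. std_normal_density x * max 0 (x - c))"
proof (rule Bochner_Integration.integrable_bound)
  show "integrable lborel (\<lambda>x. std_normal_density x * \<bar>x\<bar> + \<bar>c\<bar> * std_normal_density x)"
    using integrable_std_normal_moment_abs[of 1] by simp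
  show "AE x in lborel. norm (std_normal_density x * max 0 (x - c))
      \<le> norm (std_normal_density x * \<bar>x\<bar> + \<bar>c\<bar> * std_normal_density x)"
  proof (intro AE_I2)
    fix x :: real
    have "std_normal_density x * max 0 (x - c) \<le> std_normal_density x * (\<bar>x\<bar> + \<bar>c\<bar>)"
      by (intro mult_left_mono) auto
    then show "norm (std_normal_density x * max 0 (x - c))
      \<le> norm (std_normal_density x * \<bar>x\<bar> + \<bar>c\<bar> * std_normal_density x)"
      by (simp add: abs_mult algebra_simps)
  qed
qed measurable

lemma normal_excess_pos: "normal_excess c > 0"
proof -
  have "normal_excess c \<ge> 0"
    unfolding normal_excess_def by (intro integral_nonneg_AE AE_I2) simp
  moreover have "normal_excess c \<noteq> 0"
  proof
    assume "normal_excess c = 0"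
    then have "AE x in lborel. std_normal_density x * max 0 (x - c) = 0"
      unfolding normal_excess_def
      by (subst (asm) integral_nonneg_eq_0_iff_AE) (auto intro: integrable_normal_excess)
    then have "AE x in lborel. x \<notin> {c<..<c + 1}"
      by (rule AE_mp) (auto intro!: AE_I2 simp: max_def std_normal_density_def split: if_splits)
    then have "{c<..<c + 1} \<in> null_sets lborel"
      by (subst AE_iff_null_sets) auto
    then show False by (simp add: null_sets_def)
  qed
  ultimately show ?thesis by simp
qed

section \<open>The Gaussian random walk\<close>

locale gaussian_walk = prob_space M for M :: "'a measure" +
  fixes Z :: "nat \<Rightarrow> 'a \<Rightarrow> real"
  assumes indep_steps: "indep_vars (\<lambda>_. borel) Z {1..}"
    and normal_steps: "\<And>i. i \<ge> 1 \<Longrightarrow> distributed M lborel (Z i) std_normal_density"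
begin

definition walk :: "nat \<Rightarrow> 'a \<Rightarrow> real" where
  "walk n \<omega> = (\<Sum>i=1..n. Z i \<omega>)"

lemma walk_0 [simp]: "walk 0 \<omega> = 0"
  by (simp add: walk_def)

lemma walk_Suc: "walk (Suc n) \<omega> = walk n \<omega> + Z (Suc n) \<omega>"
  by (simp add: walk_def)

lemma integrable_step: "i \<ge> 1 \<Longrightarrow> integrable M (Z i)"
  using distributed_integrable_var[OF normal_steps] integrable_std_normal_moment[of 1] by simp

lemma expectation_step: "i \<ge> 1 \<Longrightarrow> expectation (Z i) = 0"
  using standard_normal_distributed_expectation[OF normal_steps] .

lemma integrable_walk: "integrable M (walk n)"
  unfolding walk_def by (auto intro!: integrable_step)

lemma expectation_walk: "expectation (walk n) = 0"
  unfolding walk_def by (subst Bochner_Integration.integral_sum) (auto simp: integrable_step expectation_step)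

lemma normalized_walk:
  assumes "n \<ge> 1"
  shows "distributed M lborel (\<lambda>\<omega>. walk n \<omega> / sqrt n) std_normal_density"
proof -
  have "distributed M lborel (\<lambda>\<omega>. \<Sum>i\<in>{1..n}. Z i \<omega>)
      (normal_density (\<Sum>i\<in>{1..n}. 0) (sqrt (\<Sum>i\<in>{1..n}. 1\<^sup>2)))"
    using assms by (intro sum_indep_normal indep_vars_subset[OF indep_steps] normal_steps) auto
  then have "distributed M lborel (walk n) (normal_density 0 (sqrt n))"
    by (simp add: walk_def[abs_def])
  then show ?thesis
    using assms by (subst (asm) normal_standard_normal_convert) auto
qed

lemma walk_even_moment:
  assumes "n \<ge> 1"
  shows "integrable M (\<lambda>\<omega>. walk n \<omega> ^ (2 * m))"
    and "expectation (\<lambda>\<omega>. walk n \<omega> ^ (2 * m)) = fact (2 * m) / (2 ^ m * fact m) * real n ^ m"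
proof -
  have eq: "walk n \<omega> ^ (2 * m) = real n ^ m * (walk n \<omega> / sqrt n) ^ (2 * m)" for \<omega>
    using assms by (simp add: power_divide power_mult)
  have "integrable M (\<lambda>\<omega>. (walk n \<omega> / sqrt n) ^ (2 * m))"
    using distributed_integrable[OF normalized_walk[OF assms], of "\<lambda>x. x ^ (2 * m)"]
      integrable_std_normal_moment[of "2 * m"] by simp
  then show "integrable M (\<lambda>\<omega>. walk n \<omega> ^ (2 * m))"
    unfolding eq by (rule integrable_mult_right)
  have "expectation (\<lambda>\<omega>. (walk n \<omega> / sqrt n) ^ (2 * m)) = fact (2 * m) / (2 ^ m * fact m)"
    using distributed_integral[OF normalized_walk[OF assms], of "\<lambda>x. x ^ (2 * m)"]
      integral_std_normal_moment_even[of m] by simp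
  then show "expectation (\<lambda>\<omega>. walk n \<omega> ^ (2 * m)) = fact (2 * m) / (2 ^ m * fact m) * real n ^ m"
    unfolding eq by simp
qed

lemma expectation_walk_excess:
  assumes "n \<ge> 1"
  shows "expectation (\<lambda>\<omega>. max 0 (walk n \<omega> - c * sqrt n)) = sqrt n * normal_excess c"
proof -
  have "max 0 (walk n \<omega> - c * sqrt n) = sqrt n * max 0 (walk n \<omega> / sqrt n - c)" for \<omega>
    using assms by (simp add: max_mult_distrib_left right_diff_distrib mult.commute)
  then have "expectation (\<lambda>\<omega>. max 0 (walk n \<omega> - c * sqrt n))
      = sqrt n * expectation (\<lambda>\<omega>. max 0 (walk n \<omega> / sqrt n - c))" by simp
  also have "expectation (\<lambda>\<omega>. max 0 (walk n \<omega> / sqrt n - c)) = normal_excess c"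
    unfolding normal_excess_def
    by (rule distributed_integral[OF normalized_walk[OF assms], of "\<lambda>x. max 0 (x - c)", symmetric])
      simp_all
  finally show ?thesis .
qed

text \<open>
  Markov's inequality of order \<open>2 * m\<close> in its excess form: on \<open>t < x\<close>, the excess \<open>x - t\<close> is at most
  \<open>x * (x / t) ^ (2 * m - 1)\<close>.
\<close>

lemma expectation_walk_excess_le:
  assumes "n \<ge> 1" "m \<ge> 1" "t > 0"
  shows "expectation (\<lambda>\<omega>. max 0 (walk n \<omega> - t))
    \<le> fact (2 * m) / (2 ^ m * fact m) * real n ^ m / t ^ (2 * m - 1)"
proof -
  have le: "max 0 (x - t) \<le> x ^ (2 * m) / t ^ (2 * m - 1)" for x :: real
  proof (cases "x \<le> t")
    case True
    have "x ^ (2 * m) \<ge> 0" by (simp add: power_mult)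
    with True assms show ?thesis by simp
  next
    case False
    have "(x - t) * t ^ (2 * m - 1) \<le> x * x ^ (2 * m - 1)"
      using False assms by (intro mult_mono power_mono) auto
    also have "x * x ^ (2 * m - 1) = x ^ (2 * m)"
      using assms by (simp flip: power_Suc)
    finally show ?thesis using False assms by (simp add: field_simps)
  qed
  have "expectation (\<lambda>\<omega>. max 0 (walk n \<omega> - t)) \<le> expectation (\<lambda>\<omega>. walk n \<omega> ^ (2 * m) / t ^ (2 * m - 1))"
    using walk_even_moment(1)[OF assms(1), of m]
    by (intro integral_mono le) (auto intro!: integrable_walk integrable_max)
  then show ?thesis using walk_even_moment(2)[OF assms(1), of m] by simp
qed

section \<open>The expected running maximum of the walk\<close>

text \<open>
  The running maximum at time \<open>n\<close> is a function of \<open>Z 1, \<dots>, Z n\<close> only, hence independent of the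
  next step.
\<close>

lemma indep_run_max_step:
  "indep_var borel (\<lambda>\<omega>. run_max (\<lambda>j. walk j \<omega>) n) borel (Z (Suc n))"
proof -
  let ?f = "\<lambda>z. run_max (\<lambda>j. \<Sum>i=1..j. z i) n :: real"
  have "indep_var
      borel (?f \<circ> (\<lambda>\<omega>. restrict (\<lambda>i. Z i \<omega>) {1..n}))
      borel ((\<lambda>z. z (Suc n)) \<circ> (\<lambda>\<omega>. restrict (\<lambda>i. Z i \<omega>) {Suc n}))"
  proof (intro indep_var_compose[OF indep_var_restrict[OF indep_steps]])
    show "?f \<in> borel_measurable (PiM {1..n} (\<lambda>_. borel))"
      unfolding run_max_def
      by (intro borel_measurable_Max borel_measurable_sum measurable_component_singleton) auto
  qed auto
  also have "?f \<circ> (\<lambda>\<omega>. restrict (\<lambda>i. Z i \<omega>) {1..n}) = (\<lambda>\<omega>. run_max (\<lambda>j. walk j \<omega>) n)"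
  proof
    fix \<omega>
    have "(\<Sum>i=1..j. restrict (\<lambda>i. Z i \<omega>) {1..n} i) = walk j \<omega>" if "j \<in> {0..n}" for j
      unfolding walk_def using that by (intro sum.cong) auto
    then show "(?f \<circ> (\<lambda>\<omega>. restrict (\<lambda>i. Z i \<omega>) {1..n})) \<omega> = run_max (\<lambda>j. walk j \<omega>) n"
      unfolding run_max_def comp_def by (simp only: cong: image_cong)
  qed
  also have "(\<lambda>z. z (Suc n)) \<circ> (\<lambda>\<omega>. restrict (\<lambda>i. Z i \<omega>) {Suc n}) = Z (Suc n)"
    by auto
  finally show ?thesis .
qed

lemma integrable_run_max_walk: "integrable M (\<lambda>\<omega>. run_max (\<lambda>j. walk j \<omega>) n)"
  by (intro integrable_run_max integrable_walk)

lemma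
  shows integrable_run_max_step: "integrable M (\<lambda>\<omega>. run_max (\<lambda>j. walk j \<omega>) n * Z (Suc n) \<omega>)"
    and expectation_run_max_step: "expectation (\<lambda>\<omega>. run_max (\<lambda>j. walk j \<omega>) n * Z (Suc n) \<omega>) = 0"
  using indep_var_integrable[OF indep_run_max_step integrable_run_max_walk integrable_step]
    indep_var_lebesgue_integral[OF indep_run_max_step integrable_run_max_walk integrable_step]
  by (auto simp: expectation_step)

lemma expectation_run_max_walk_le:
  assumes "n \<ge> 1"
  shows "expectation (\<lambda>\<omega>. run_max (\<lambda>j. walk j \<omega>) n) \<le> 5 / 2 * sqrt n"
proof -
  let ?M = "\<lambda>k \<omega>. run_max (\<lambda>j. walk j \<omega>) k"
  let ?B = "\<lambda>\<omega>. 4 * (walk n \<omega>)\<^sup>2 - 4 * (\<Sum>k<n. ?M k \<omega> * Z (Suc k) \<omega>)"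
  have s: "sqrt n > 0" using assms by simp
  have int: "integrable M (\<lambda>\<omega>. (walk n \<omega>)\<^sup>2)" and ex: "expectation (\<lambda>\<omega>. (walk n \<omega>)\<^sup>2) = real n"
    using walk_even_moment[OF assms, of 1] by (simp_all add: fact_numeral)
  have intB: "integrable M ?B"
    using int
    by (intro Bochner_Integration.integrable_diff integrable_mult_right
        Bochner_Integration.integrable_sum integrable_run_max_step) auto
  have exB: "expectation ?B = 4 * n"
    using int ex by (simp add: integrable_run_max_step expectation_run_max_step)
  \<comment> \<open>The bound \<open>a \<le> (a\<^sup>2 / s + s) / 2\<close> with \<open>s = sqrt n\<close> turns the second moment into a first one.\<close>
  have le: "?M n \<omega> \<le> (?B \<omega> / sqrt n + sqrt n) / 2" for \<omega>
  proof -
    have "0 \<le> (?M n \<omega> - sqrt n)\<^sup>2" by simp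
    then have "2 * sqrt n * ?M n \<omega> \<le> (?M n \<omega>)\<^sup>2 + (sqrt n)\<^sup>2"
      by (simp only: power2_diff) (simp add: algebra_simps)
    also have "(?M n \<omega>)\<^sup>2 \<le> ?B \<omega>"
      using run_max_square_le[of "\<lambda>j. walk j \<omega>" n] by (simp add: walk_Suc)
    finally have *: "2 * sqrt n * ?M n \<omega> \<le> ?B \<omega> + (sqrt n)\<^sup>2" by simp
    have "?M n \<omega> = (2 * sqrt n * ?M n \<omega>) / (2 * sqrt n)" using s by simp
    also have "\<dots> \<le> (?B \<omega> + (sqrt n)\<^sup>2) / (2 * sqrt n)"
      using * s by (intro divide_right_mono) auto
    also have "\<dots> = (?B \<omega> / sqrt n + sqrt n) / 2"
      using s by (simp only: power2_eq_square) (simp add: field_simps)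
    finally show ?thesis .
  qed
  have "expectation (?M n) \<le> expectation (\<lambda>\<omega>. (?B \<omega> / sqrt n + sqrt n) / 2)"
  proof (rule integral_mono[OF integrable_run_max_walk _ le])
    show "integrable M (\<lambda>\<omega>. (?B \<omega> / sqrt n + sqrt n) / 2)"
      by (intro integrable_divide Bochner_Integration.integrable_add integrable_const intB)
  qed
  also have "\<dots> = (expectation ?B / sqrt n + sqrt n) / 2"
    using intB by (simp add: prob_space del: integral_diff Bochner_Integration.integral_diff)
  also have "\<dots> = 5 / 2 * sqrt n"
    unfolding exB using s by (simp add: real_div_sqrt field_simps)
  finally show ?thesis .
qed

section \<open>Bounds on the expected lost sales\<close>

lemma net_demand_walk:
  "n \<ge> 1 \<Longrightarrow> net_demand \<sigma> \<alpha> \<kappa> Z n \<omega> = \<sigma> * (walk n \<omega> - \<kappa> * real n powr \<alpha>)"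
  by (simp add: net_demand_def walk_def algebra_simps)

lemma net_demand_0: "net_demand \<sigma> \<alpha> \<kappa> Z 0 \<omega> = 0"
  by (simp add: net_demand_def)

lemma lost_sales_run_max: "lost_sales \<sigma> \<alpha> \<kappa> Z N \<omega> = run_max (\<lambda>j. net_demand \<sigma> \<alpha> \<kappa> Z j \<omega>) N"
  by (simp add: lost_sales_def run_max_def)

lemma integrable_net_demand: "integrable M (net_demand \<sigma> \<alpha> \<kappa> Z n)"
proof (cases "n = 0")
  case True
  then show ?thesis by (simp add: net_demand_0[abs_def])
next
  case False
  then have "net_demand \<sigma> \<alpha> \<kappa> Z n = (\<lambda>\<omega>. \<sigma> * (walk n \<omega> - \<kappa> * real n powr \<alpha>))"
    by (auto simp: net_demand_walk)
  then show ?thesis by (auto intro!: integrable_walk)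
qed

lemma integrable_lost_sales: "integrable M (lost_sales \<sigma> \<alpha> \<kappa> Z N)"
  unfolding lost_sales_run_max[abs_def] by (intro integrable_run_max integrable_net_demand)

lemma lost_sales_nonneg: "0 \<le> lost_sales \<sigma> \<alpha> \<kappa> Z N \<omega>"
  using run_max_ge[of 0 N "\<lambda>j. net_demand \<sigma> \<alpha> \<kappa> Z j \<omega>"] by (simp add: lost_sales_run_max net_demand_0)

lemma lost_sales_ge: "N \<ge> 1 \<Longrightarrow> \<sigma> * (walk N \<omega> - \<kappa> * real N powr \<alpha>) \<le> lost_sales \<sigma> \<alpha> \<kappa> Z N \<omega>"
  using run_max_ge[of N N "\<lambda>j. net_demand \<sigma> \<alpha> \<kappa> Z j \<omega>"]
  by (simp add: lost_sales_run_max net_demand_walk)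

lemma expectation_lost_sales_le:
  assumes "\<sigma> > 0" "\<alpha> \<ge> 0" "N \<ge> 1"
  shows "expectation (lost_sales \<sigma> \<alpha> \<kappa> Z N) \<le> \<sigma> * (5 / 2 * sqrt N + max 0 (- \<kappa>) * real N powr \<alpha>)"
proof -
  let ?D = "max 0 (- \<kappa>) * real N powr \<alpha>"
  have le: "lost_sales \<sigma> \<alpha> \<kappa> Z N \<omega> \<le> \<sigma> * (run_max (\<lambda>j. walk j \<omega>) N + ?D)" for \<omega>
    unfolding lost_sales_run_max run_max_le_iff
  proof (intro allI impI)
    fix j assume j: "j \<le> N"
    have W: "walk j \<omega> \<le> run_max (\<lambda>j. walk j \<omega>) N" using j by (rule run_max_ge)
    show "net_demand \<sigma> \<alpha> \<kappa> Z j \<omega> \<le> \<sigma> * (run_max (\<lambda>j. walk j \<omega>) N + ?D)"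
    proof (cases "j = 0")
      case True
      with W assms show ?thesis by (simp add: net_demand_0)
    next
      case False
      have "- \<kappa> * real j powr \<alpha> \<le> max 0 (- \<kappa>) * real j powr \<alpha>"
        by (intro mult_right_mono) auto
      also have "\<dots> \<le> ?D"
        using j assms by (intro mult_left_mono powr_mono2) auto
      finally show ?thesis
        using W False assms by (simp add: net_demand_walk)
    qed
  qed
  have "expectation (lost_sales \<sigma> \<alpha> \<kappa> Z N) \<le> expectation (\<lambda>\<omega>. \<sigma> * (run_max (\<lambda>j. walk j \<omega>) N + ?D))"
    by (rule integral_mono[OF integrable_lost_sales _ le]) (auto intro!: integrable_run_max_walk)
  also have "\<dots> = \<sigma> * (expectation (\<lambda>\<omega>. run_max (\<lambda>j. walk j \<omega>) N) + ?D)"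
    by (simp add: integrable_run_max_walk prob_space)
  also have "\<dots> \<le> \<sigma> * (5 / 2 * sqrt N + ?D)"
    using expectation_run_max_walk_le[OF assms(3)] assms by (intro mult_left_mono add_right_mono) auto
  finally show ?thesis .
qed

lemma expectation_lost_sales_ge_drift:
  assumes "N \<ge> 1"
  shows "\<sigma> * (- \<kappa>) * real N powr \<alpha> \<le> expectation (lost_sales \<sigma> \<alpha> \<kappa> Z N)"
proof -
  have "expectation (\<lambda>\<omega>. \<sigma> * (walk N \<omega> - \<kappa> * real N powr \<alpha>)) \<le> expectation (lost_sales \<sigma> \<alpha> \<kappa> Z N)"
    by (intro integral_mono integrable_lost_sales lost_sales_ge assms) (auto intro!: integrable_walk)
  then show ?thesis
    by (simp add: integrable_walk expectation_walk prob_space)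
qed

lemma powr_le_sqrt: "x \<ge> 1 \<Longrightarrow> \<alpha> \<le> 1/2 \<Longrightarrow> x powr \<alpha> \<le> sqrt x"
  by (simp add: powr_mono flip: powr_half_sqrt)

lemma expectation_lost_sales_ge_sqrt:
  assumes "\<sigma> > 0" "\<alpha> \<le> 1/2" "N \<ge> 1"
  shows "\<sigma> * normal_excess \<bar>\<kappa>\<bar> * sqrt N \<le> expectation (lost_sales \<sigma> \<alpha> \<kappa> Z N)"
proof -
  have le: "\<sigma> * max 0 (walk N \<omega> - \<bar>\<kappa>\<bar> * sqrt N) \<le> lost_sales \<sigma> \<alpha> \<kappa> Z N \<omega>" for \<omega>
  proof -
    have "\<kappa> * real N powr \<alpha> \<le> \<bar>\<kappa>\<bar> * real N powr \<alpha>" by (intro mult_right_mono) auto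
    also have "\<dots> \<le> \<bar>\<kappa>\<bar> * sqrt N"
      using assms by (intro mult_left_mono powr_le_sqrt) auto
    finally have "\<sigma> * (walk N \<omega> - \<bar>\<kappa>\<bar> * sqrt N) \<le> \<sigma> * (walk N \<omega> - \<kappa> * real N powr \<alpha>)"
      using assms by (intro mult_left_mono) auto
    with lost_sales_ge[OF assms(3)] have "\<sigma> * (walk N \<omega> - \<bar>\<kappa>\<bar> * sqrt N) \<le> lost_sales \<sigma> \<alpha> \<kappa> Z N \<omega>"
      by (rule order_trans[rotated])
    with lost_sales_nonneg show ?thesis by (simp add: max_def)
  qed
  have "expectation (\<lambda>\<omega>. \<sigma> * max 0 (walk N \<omega> - \<bar>\<kappa>\<bar> * sqrt N)) \<le> expectation (lost_sales \<sigma> \<alpha> \<kappa> Z N)"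
    by (intro integral_mono integrable_lost_sales le) (auto intro!: integrable_walk integrable_max)
  then show ?thesis
    using expectation_walk_excess[OF assms(3)] by (simp add: mult_ac)
qed

lemma expectation_lost_sales_le_sum:
  assumes "\<sigma> > 0"
  shows "expectation (lost_sales \<sigma> \<alpha> \<kappa> Z N)
    \<le> (\<Sum>j=1..N. \<sigma> * expectation (\<lambda>\<omega>. max 0 (walk j \<omega> - \<kappa> * real j powr \<alpha>)))"
proof -
  let ?e = "\<lambda>j \<omega>. \<sigma> * max 0 (walk j \<omega> - \<kappa> * real j powr \<alpha>)"
  have le: "lost_sales \<sigma> \<alpha> \<kappa> Z N \<omega> \<le> (\<Sum>j=1..N. ?e j \<omega>)" for \<omega>
    unfolding lost_sales_run_max run_max_le_iff
  proof (intro allI impI)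
    fix j assume j: "j \<le> N"
    have pos: "?e i \<omega> \<ge> 0" for i using assms by simp
    show "net_demand \<sigma> \<alpha> \<kappa> Z j \<omega> \<le> (\<Sum>j=1..N. ?e j \<omega>)"
    proof (cases "j = 0")
      case True
      then show ?thesis using pos by (simp add: net_demand_0 sum_nonneg)
    next
      case False
      then have "net_demand \<sigma> \<alpha> \<kappa> Z j \<omega> \<le> ?e j \<omega>"
        using assms by (simp add: net_demand_walk)
      also have "\<dots> \<le> (\<Sum>j=1..N. ?e j \<omega>)"
        using False j pos by (intro member_le_sum) auto
      finally show ?thesis .
    qed
  qed
  have int: "integrable M (?e j)" for j
    by (auto intro!: integrable_walk integrable_max)
  have "expectation (lost_sales \<sigma> \<alpha> \<kappa> Z N) \<le> expectation (\<lambda>\<omega>. \<Sum>j=1..N. ?e j \<omega>)"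
    by (intro integral_mono integrable_lost_sales le Bochner_Integration.integrable_sum int)
  also have "\<dots> = (\<Sum>j=1..N. expectation (?e j))"
    by (intro Bochner_Integration.integral_sum int)
  finally show ?thesis by simp
qed

text \<open>
  With the moment of order \<open>2 * m\<close>, the \<open>j\<close>-th positive part contributes a term of order at most
  \<open>j powr (\<alpha> - m * (2 * \<alpha> - 1))\<close>, which is summable for large \<open>m\<close> precisely because \<open>\<alpha> > 1/2\<close>.
\<close>

lemma bounded_expectation_lost_sales:
  assumes "\<sigma> > 0" "\<kappa> > 0" "\<alpha> > 1/2"
  shows "bounded (range (\<lambda>N. expectation (lost_sales \<sigma> \<alpha> \<kappa> Z N)))"
proof -
  define m where "m = Suc (nat \<lceil>(\<alpha> + 2) / (2 * \<alpha> - 1)\<rceil>)"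
  have m: "m \<ge> 1" by (simp add: m_def)
  have "(\<alpha> + 2) / (2 * \<alpha> - 1) \<le> m" unfolding m_def by linarith
  then have "\<alpha> + 2 \<le> m * (2 * \<alpha> - 1)" using assms by (simp add: field_simps)
  then have exponent: "\<alpha> - m * (2 * \<alpha> - 1) < -1" by linarith
  define C where "C = \<sigma> * (fact (2 * m) / (2 ^ m * fact m) / \<kappa> ^ (2 * m - 1))"
  let ?b = "\<lambda>j::nat. C * real j powr (\<alpha> - m * (2 * \<alpha> - 1))"
  have C: "C \<ge> 0" using assms by (simp add: C_def)
  have term_le: "\<sigma> * expectation (\<lambda>\<omega>. max 0 (walk j \<omega> - \<kappa> * real j powr \<alpha>)) \<le> ?b j"
    if "j \<ge> 1" for j
  proof -
    have "(real j powr \<alpha>) ^ (2 * m - 1) = real j powr (\<alpha> * (2 * real m - 1))"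
      using that m by (simp add: powr_powr of_nat_diff flip: powr_realpow)
    moreover have "real j ^ m = real j powr m" using that by (simp add: powr_realpow)
    moreover have "real m - \<alpha> * (2 * real m - 1) = \<alpha> - m * (2 * \<alpha> - 1)" by (simp add: algebra_simps)
    ultimately have quotient: "real j ^ m / (real j powr \<alpha>) ^ (2 * m - 1)
        = real j powr (\<alpha> - m * (2 * \<alpha> - 1))"
      by (metis powr_diff)
    have "?b j = \<sigma> * (fact (2 * m) / (2 ^ m * fact m) * real j ^ m / (\<kappa> * real j powr \<alpha>) ^ (2 * m - 1))"
      by (simp add: C_def power_mult_distrib flip: quotient)
    moreover have "\<kappa> * real j powr \<alpha> > 0" using assms that by simp
    ultimately show ?thesis
      using mult_left_mono[OF expectation_walk_excess_le[OF that m], of "\<kappa> * real j powr \<alpha>" \<sigma>] assms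
      by simp
  qed
  have summable: "summable ?b"
    using exponent by (intro summable_mult) (simp add: summable_real_powr_iff)
  have "norm (expectation (lost_sales \<sigma> \<alpha> \<kappa> Z N)) \<le> suminf ?b" for N
  proof -
    have "expectation (lost_sales \<sigma> \<alpha> \<kappa> Z N) \<le> (\<Sum>j=1..N. ?b j)"
      by (rule order_trans[OF expectation_lost_sales_le_sum[OF assms(1)] sum_mono])
        (simp add: term_le)
    also have "\<dots> \<le> suminf ?b"
      using C by (intro sum_le_suminf summable) auto
    finally show ?thesis
      using lost_sales_nonneg by (simp add: integral_nonneg_AE)
  qed
  then show ?thesis by (auto simp: bounded_iff)
qed

lemma grows_sqrt:
  assumes "\<sigma> > 0" "\<alpha> \<in> {0..1/2}"
  shows "grows_on_order_of (\<lambda>N. expectation (lost_sales \<sigma> \<alpha> \<kappa> Z N)) (\<lambda>N. sqrt (real N))"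
proof -
  define c1 where "c1 = \<sigma> * normal_excess \<bar>\<kappa>\<bar>"
  define c2 where "c2 = \<sigma> * (5 / 2 + max 0 (- \<kappa>))"
  have bounds: "c1 * sqrt N \<le> expectation (lost_sales \<sigma> \<alpha> \<kappa> Z N)"
      "expectation (lost_sales \<sigma> \<alpha> \<kappa> Z N) \<le> c2 * sqrt N" if "N \<ge> 1" for N :: nat
  proof -
    show "c1 * sqrt N \<le> expectation (lost_sales \<sigma> \<alpha> \<kappa> Z N)"
      unfolding c1_def using expectation_lost_sales_ge_sqrt that assms by simp
    have "max 0 (- \<kappa>) * real N powr \<alpha> \<le> max 0 (- \<kappa>) * sqrt N"
      using that assms by (intro mult_left_mono powr_le_sqrt) auto
    then have "\<sigma> * (5 / 2 * sqrt N + max 0 (- \<kappa>) * real N powr \<alpha>)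
        \<le> \<sigma> * (5 / 2 * sqrt N + max 0 (- \<kappa>) * sqrt N)"
      using assms by (intro mult_left_mono) auto
    also have "\<dots> = c2 * sqrt N" by (simp add: c2_def algebra_simps)
    finally show "expectation (lost_sales \<sigma> \<alpha> \<kappa> Z N) \<le> c2 * sqrt N"
      using expectation_lost_sales_le[of \<sigma> \<alpha> N \<kappa>] that assms by simp
  qed
  have "c1 > 0" unfolding c1_def using assms normal_excess_pos by simp
  moreover have "c1 \<le> c2" using bounds[of 1] by simp
  moreover have "\<forall>\<^sub>F N in sequentially. c1 * sqrt (real N) \<le> expectation (lost_sales \<sigma> \<alpha> \<kappa> Z N)
      \<and> expectation (lost_sales \<sigma> \<alpha> \<kappa> Z N) \<le> c2 * sqrt (real N)"
    using eventually_ge_at_top[of 1] by eventually_elim (simp add: bounds)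
  ultimately show ?thesis unfolding grows_on_order_of_def by blast
qed

lemma grows_powr:
  assumes "\<sigma> > 0" "\<kappa> < 0" "\<alpha> > 1/2"
  shows "grows_on_order_of (\<lambda>N. expectation (lost_sales \<sigma> \<alpha> \<kappa> Z N)) (\<lambda>N. real N powr \<alpha>)"
proof -
  define c1 where "c1 = \<sigma> * (- \<kappa>)"
  define c2 where "c2 = \<sigma> * (5 / 2 - \<kappa>)"
  have bounds: "c1 * real N powr \<alpha> \<le> expectation (lost_sales \<sigma> \<alpha> \<kappa> Z N)"
      "expectation (lost_sales \<sigma> \<alpha> \<kappa> Z N) \<le> c2 * real N powr \<alpha>" if "N \<ge> 1" for N :: nat
  proof -
    show "c1 * real N powr \<alpha> \<le> expectation (lost_sales \<sigma> \<alpha> \<kappa> Z N)"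
      unfolding c1_def using expectation_lost_sales_ge_drift that by simp
    have "sqrt N \<le> real N powr \<alpha>"
      using that assms by (simp add: powr_mono flip: powr_half_sqrt)
    then have "\<sigma> * (5 / 2 * sqrt N + max 0 (- \<kappa>) * real N powr \<alpha>)
        \<le> \<sigma> * (5 / 2 * real N powr \<alpha> + max 0 (- \<kappa>) * real N powr \<alpha>)"
      using assms by (intro mult_left_mono) auto
    also have "\<dots> = c2 * real N powr \<alpha>" using assms by (simp add: c2_def algebra_simps)
    finally show "expectation (lost_sales \<sigma> \<alpha> \<kappa> Z N) \<le> c2 * real N powr \<alpha>"
      using expectation_lost_sales_le[of \<sigma> \<alpha> N \<kappa>] that assms by simp
  qed
  have "c1 > 0" unfolding c1_def using assms by (simp add: mult_pos_neg)
  moreover have "c1 \<le> c2" unfolding c1_def c2_def using assms by (intro mult_left_mono) auto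
  moreover have "\<forall>\<^sub>F N in sequentially. c1 * real N powr \<alpha> \<le> expectation (lost_sales \<sigma> \<alpha> \<kappa> Z N)
      \<and> expectation (lost_sales \<sigma> \<alpha> \<kappa> Z N) \<le> c2 * real N powr \<alpha>"
    using eventually_ge_at_top[of 1] by eventually_elim (simp add: bounds)
  ultimately show ?thesis unfolding grows_on_order_of_def by blast
qed

end

section \<open>Growth of the expected lost sales\<close>

theorem mainTheorem1:
  fixes M :: "'a measure" and Z :: "nat \<Rightarrow> 'a \<Rightarrow> real" and \<sigma> \<alpha> \<kappa> :: real
  assumes "prob_space M"
    and "\<sigma> > 0" and "\<alpha> \<in> {0..1}"
    and indep: "prob_space.indep_vars M (\<lambda>_. borel) Z {1..}"
    and normal: "\<And>i. i \<ge> 1 \<Longrightarrow> distributed M lborel (Z i) std_normal_density"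
  defines "EL \<equiv> (\<lambda>N. prob_space.expectation M (lost_sales \<sigma> \<alpha> \<kappa> Z N))"
  shows "(\<kappa> > 0 \<and> \<alpha> \<in> {1/2<..1} \<longrightarrow> bounded (range EL)) \<and>
         (\<kappa> > 0 \<and> \<alpha> \<in> {0..1/2} \<longrightarrow> grows_on_order_of EL (\<lambda>N. sqrt (real N))) \<and>
         (\<kappa> < 0 \<and> \<alpha> \<in> {1/2<..1} \<longrightarrow> grows_on_order_of EL (\<lambda>N. real N powr \<alpha>)) \<and>
         (\<kappa> < 0 \<and> \<alpha> \<in> {0..1/2} \<longrightarrow> grows_on_order_of EL (\<lambda>N. sqrt (real N)))"
proof -
  interpret gaussian_walk M Z
    using assms(1) indep normal by (auto simp: gaussian_walk_def gaussian_walk_axioms_def)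
  show ?thesis
    unfolding EL_def using \<open>\<sigma> > 0\<close>
    by (auto intro: bounded_expectation_lost_sales grows_sqrt grows_powr)
qed

end
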